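(* Let $n$ be a positive integer and let $J$ be an M-ideal of $C([0,1]^n)$. Then the metric projection $P_J$ has a linear selection.
   Context: $C([0,1]^n)$ is the space of continuous scalar-valued functions on $[0,1]^n$ with the sup norm. A closed subspace $J$ of a Banach space $X$ is an M-ideal if its annihilator $J^\perp$ is an L-summand of $X^*$, i.e. there is a linear projection $P$ of $X^*$ onto $J^\perp$ with $\|x^*\|=\|Px^*\|+\|x^*-Px^*\|$ for all $x^*\in X^*$. The metric projection onto $J$ is the set-valued map $P_J(x)=\{j\in J:\|x-j\|=\mathrm{dist}(x,J)\}$; a linear selection for $P_J$ is a linear map $p:X\to J$ with $p(x)\in P_J(x)$ for every $x\in X$. *)

theory Defs
  imports "HOL-Analysis.Analysis"
begin

text \<open>The cube \<open>[0,1]\<^sup>n\<close> with the subspace metric of Euclidean space; \<open>n = CARD('n) \<ge> 1\<close>.\<close>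

typedef 'n::finite unit_cube = "{x :: real ^ 'n. \<forall>i. 0 \<le> x $ i \<and> x $ i \<le> 1}"
  by (rule exI[of _ 0]) simp

instantiation unit_cube :: (finite) metric_space
begin

definition dist_unit_cube :: "'a unit_cube \<Rightarrow> 'a unit_cube \<Rightarrow> real"
  where "dist_unit_cube x y = dist (Rep_unit_cube x) (Rep_unit_cube y)"

definition uniformity_unit_cube :: "('a unit_cube \<times> 'a unit_cube) filter"
  where "uniformity_unit_cube = (INF e\<in>{0<..}. principal {(x, y). dist x y < e})"

definition open_unit_cube :: "'a unit_cube set \<Rightarrow> bool"
  where "open_unit_cube U \<longleftrightarrow>
    (\<forall>x\<in>U. eventually (\<lambda>(x', y). x' = x \<longrightarrow> y \<in> U) uniformity)"

instance
proof
  fix x y z :: "'a unit_cube"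
  show "dist x y = 0 \<longleftrightarrow> x = y"
    by (simp add: dist_unit_cube_def Rep_unit_cube_inject)
  show "dist x y \<le> dist x z + dist y z"
    by (simp add: dist_unit_cube_def dist_triangle2)
qed (rule uniformity_unit_cube_def open_unit_cube_def)+

end

lemma compact_UNIV_unit_cube: "compact (UNIV :: 'n::finite unit_cube set)"
proof -
  let ?K = "{x :: real ^ 'n. \<forall>i. 0 \<le> x $ i \<and> x $ i \<le> 1}"
  have K: "?K = cbox 0 1"
    by (auto simp: mem_box_cart)
  have "continuous_on ?K Abs_unit_cube"
    by (auto simp: continuous_on_iff dist_unit_cube_def Abs_unit_cube_inverse)
  then have "compact (Abs_unit_cube ` ?K)"
    by (rule compact_continuous_image) (simp add: K)
  moreover have "Abs_unit_cube ` ?K = UNIV"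
    using type_definition.Abs_image[OF type_definition_unit_cube] .
  ultimately show ?thesis by simp
qed

text \<open>\<open>C([0,1]\<^sup>n)\<close> is the type of bounded continuous functions on the cube, with the sup norm of
  \<open>Bounded_Continuous_Function\<close>. Boundedness is automatic by compactness:\<close>

lemma continuous_unit_cube_bcontfun:
  fixes f :: "'n::finite unit_cube \<Rightarrow> 'b::metric_space"
  assumes "continuous_on UNIV f"
  shows "f \<in> bcontfun"
  using assms compact_imp_bounded[OF compact_continuous_image[OF assms compact_UNIV_unit_cube]]
  by (simp add: bcontfun_def)

instance bcontfun :: (metric_space, banach) banach ..

text \<open>Scalar multiplication on \<open>C([0,1]\<^sup>n)\<close> by the scalar field itself; the library only provides
  the multiplication by reals, which does not suffice for complex scalars.\<close>

definition bcf_scale :: "'k::real_normed_field \<Rightarrow> ('a::topological_space \<Rightarrow>\<^sub>C 'k) \<Rightarrow> ('a \<Rightarrow>\<^sub>C 'k)"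
  where "bcf_scale c f = Bcontfun (\<lambda>x. c * apply_bcontfun f x)"

lemma apply_bcf_scale [simp]:
  fixes f :: "'a::topological_space \<Rightarrow>\<^sub>C 'k::real_normed_field"
  shows "apply_bcontfun (bcf_scale c f) x = c * apply_bcontfun f x"
proof -
  have "bounded (range (apply_bcontfun f))" by simp
  then obtain B where B: "\<And>x. norm (apply_bcontfun f x) \<le> B"
    by (auto simp: bounded_iff)
  have "bounded (range (\<lambda>x. c * apply_bcontfun f x))"
    unfolding bounded_iff
    by (rule exI[of _ "norm c * B"]) (auto simp: norm_mult intro!: mult_left_mono B)
  then have "(\<lambda>x. c * apply_bcontfun f x) \<in> bcontfun"
    by (auto simp: bcontfun_def intro!: continuous_intros)
  then show ?thesis by (simp add: bcf_scale_def Bcontfun_inverse)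
qed

lemma vector_space_bcf_scale: "vector_space bcf_scale"
  by unfold_locales
    (auto intro!: bcontfun_eqI simp: plus_bcontfun.rep_eq algebra_simps)

lemma bcf_scale_of_real: "bcf_scale (of_real r) f = r *\<^sub>R f"
  by (rule bcontfun_eqI) (simp add: scaleR_bcontfun.rep_eq scaleR_conv_of_real)

text \<open>Below, \<open>s\<close> is the scalar multiplication of a Banach space \<open>'x\<close> over the scalar field \<open>'k\<close>.
  The dual consists of plain functions, its norm being \<^const>\<open>onorm\<close>; as its
  elements form a subset of a function type, linearity of a map on the dual is spelled out.\<close>

definition dual_space :: "('k::real_normed_field \<Rightarrow> 'x::banach \<Rightarrow> 'x) \<Rightarrow> ('x \<Rightarrow> 'k) set"
  where "dual_space s = {\<phi>. Vector_Spaces.linear s (*) \<phi> \<and> continuous_on UNIV \<phi>}"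

definition annihilator ::
    "('k::real_normed_field \<Rightarrow> 'x::banach \<Rightarrow> 'x) \<Rightarrow> 'x set \<Rightarrow> ('x \<Rightarrow> 'k) set"
  where "annihilator s J = {\<phi> \<in> dual_space s. \<forall>x\<in>J. \<phi> x = 0}"

definition dual_projection_onto ::
    "('k::real_normed_field \<Rightarrow> 'x::banach \<Rightarrow> 'x) \<Rightarrow> ('x \<Rightarrow> 'k) set \<Rightarrow>
      (('x \<Rightarrow> 'k) \<Rightarrow> ('x \<Rightarrow> 'k)) \<Rightarrow> bool"
  where "dual_projection_onto s Y P \<longleftrightarrow>
    (\<forall>\<phi>\<in>dual_space s. \<forall>\<psi>\<in>dual_space s. P (\<lambda>x. \<phi> x + \<psi> x) = (\<lambda>x. P \<phi> x + P \<psi> x)) \<and>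
    (\<forall>c. \<forall>\<phi>\<in>dual_space s. P (\<lambda>x. c * \<phi> x) = (\<lambda>x. c * P \<phi> x)) \<and>
    P ` dual_space s = Y \<and>
    (\<forall>\<phi>\<in>dual_space s. P (P \<phi>) = P \<phi>)"

definition dual_L_summand ::
    "('k::real_normed_field \<Rightarrow> 'x::banach \<Rightarrow> 'x) \<Rightarrow> ('x \<Rightarrow> 'k) set \<Rightarrow> bool"
  where "dual_L_summand s Y \<longleftrightarrow> Y \<subseteq> dual_space s \<and>
    (\<exists>P. dual_projection_onto s Y P \<and>
      (\<forall>\<phi>\<in>dual_space s. onorm \<phi> = onorm (P \<phi>) + onorm (\<lambda>x. \<phi> x - P \<phi> x)))"

definition M_ideal :: "('k::real_normed_field \<Rightarrow> 'x::banach \<Rightarrow> 'x) \<Rightarrow> 'x set \<Rightarrow> bool"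
  where "M_ideal s J \<longleftrightarrow>
    module.subspace s J \<and> closed J \<and> dual_L_summand s (annihilator s J)"

definition metric_projection :: "'x::banach set \<Rightarrow> 'x \<Rightarrow> 'x set"
  where "metric_projection J x = {j \<in> J. norm (x - j) = infdist x J}"

definition linear_selection ::
    "('k::real_normed_field \<Rightarrow> 'x::banach \<Rightarrow> 'x) \<Rightarrow> ('x \<Rightarrow> 'x set) \<Rightarrow> ('x \<Rightarrow> 'x) \<Rightarrow> bool"
  where "linear_selection s F p \<longleftrightarrow> Vector_Spaces.linear s s p \<and> (\<forall>x. p x \<in> F x)"

end

theory Submission imports Defs begin

text \<open>
  The proof shows that an M-ideal \<open>J\<close> of \<open>C(K)\<close>, for \<open>K\<close> the cube, consists of all functions that
  vanish on a closed set \<open>D \<subseteq> K\<close>, and then uses a linear extension operator of norm one from \<open>D\<close>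
  to \<open>K\<close>.

  For the first part, let \<open>h\<close> be a continuous function with \<open>0 \<le> h \<le> 1\<close>. A functional \<open>\<phi>\<close> on \<open>C(K)\<close>
  is the sum of \<open>\<phi>(h \<cdot>)\<close> and \<open>\<phi>((1 - h) \<cdot>)\<close>, and the norms add up
  (\<open>onorm_modulate_split\<close>), as for the parts \<open>h \<mu>\<close> and \<open>(1 - h) \<mu>\<close> of a measure \<open>\<mu>\<close>. An
  L-summand contains, with any element, both parts of such a norm-additive splitting
  (\<open>L_summand_hereditary\<close>). So the annihilator of \<open>J\<close> is invariant under \<open>\<phi> \<mapsto> \<phi>(h \<cdot>)\<close>, and \<open>J\<close>
  itself is invariant under multiplication by \<open>h\<close>, because a closed subspace is the common kernel of
  its annihilator by the Hahn-Banach theorem. Now let \<open>D\<close> be the set of common zeros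
  of \<open>J\<close>. A function that vanishes on \<open>D\<close> agrees at each point of \<open>K\<close> with some
  element of \<open>J\<close>; a partition of unity glues these elements, so the function is in \<open>J\<close>
  (\<open>closed_ideal_is_vanishing_ideal\<close>).

  For the second part, if \<open>D\<close> is empty, then \<open>J = C(K)\<close> and the identity is a selection.
  Otherwise choose a dense sequence \<open>a\<^sub>k\<close> in \<open>D\<close>. Off \<open>D\<close>, the extension of \<open>f\<close> is a
  weighted mean of the values \<open>f(a\<^sub>k)\<close>, where \<open>a\<^sub>k\<close> has positive weight at \<open>x\<close> only if its distance from
  \<open>x\<close> is less than twice the distance of \<open>x\<close> from \<open>D\<close> (Dugundji's idea). The resulting operator
  \<open>extend\<close> is linear and contractive, and \<open>extend f\<close> depends only on the restriction of \<open>f\<close> to \<open>D\<close>.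
  Hence \<open>f - extend f\<close> is in \<open>J\<close>, and \<open>\<parallel>extend f\<parallel> = \<parallel>extend (f - j)\<parallel> \<le> \<parallel>f - j\<parallel>\<close> for every \<open>j \<in> J\<close>:
  the map \<open>f \<mapsto> f - extend f\<close> is a linear selection
  (\<open>linear_selection_of_contractive_projection\<close>).

  Real and complex scalars are treated together, except for the Hahn-Banach theorem.
\<close>

section \<open>Linear functionals below a sublinear functional\<close>

definition sublinear :: "('a::real_vector \<Rightarrow> real) \<Rightarrow> bool"
  where "sublinear p \<longleftrightarrow> (\<forall>x y. p (x + y) \<le> p x + p y) \<and> (\<forall>r\<ge>0. \<forall>x. p (r *\<^sub>R x) = r * p x)"

lemma sublinear_add: "sublinear p \<Longrightarrow> p (x + y) \<le> p x + p y"
  by (simp add: sublinear_def)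

lemma sublinear_scale: "sublinear p \<Longrightarrow> 0 \<le> r \<Longrightarrow> p (r *\<^sub>R x) = r * p x"
  by (simp add: sublinear_def)

lemma sublinear_0: "sublinear p \<Longrightarrow> p 0 = 0"
  using sublinear_scale[of p 0 0] by simp

lemma sublinear_minus: "sublinear p \<Longrightarrow> - p (- x) \<le> p x"
  using sublinear_add[of p x "- x"] by (simp add: sublinear_0)

lemma sublinearI:
  assumes add: "\<And>x y. p (x + y) \<le> p x + p y" and zero: "p 0 = 0"
    and scale: "\<And>r x. 0 < r \<Longrightarrow> p (r *\<^sub>R x) \<le> r * p x"
  shows "sublinear p"
proof -
  have "p (r *\<^sub>R x) = r * p x" if "r \<ge> 0" for r x
  proof (cases "r = 0")
    case False
    with that have r: "r > 0" by simp
    have "r * p x = r * p ((1 / r) *\<^sub>R r *\<^sub>R x)" using r by simp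
    also have "\<dots> \<le> r * ((1 / r) * p (r *\<^sub>R x))"
      using r scale[of "1 / r" "r *\<^sub>R x"] by (intro mult_left_mono) auto
    finally show ?thesis using r scale[OF r, of x] by simp
  qed (simp add: zero)
  with add show ?thesis by (simp add: sublinear_def)
qed

text \<open>The functional \<open>q x = (INF t\<ge>0. p (x + t z) - t p z)\<close> is the largest sublinear functional below
  \<open>p\<close> that takes a value at most \<open>- p z\<close> at \<open>- z\<close>. A minimal sublinear functional must agree with
  its \<open>q\<close> for every \<open>z\<close>, which makes it additive; and a linear functional below \<open>q\<close> agrees with
  \<open>p\<close> at \<open>z\<close>.\<close>

lemma sublinear_decrease:
  fixes p :: "'a::real_vector \<Rightarrow> real"
  assumes p: "sublinear p"
  obtains q where "sublinear q" "\<And>x. q x \<le> p x" "\<And>x. q x \<le> p (x + z) - p z"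
proof
  define q where "q x = (INF t\<in>{0..}. p (x + t *\<^sub>R z) - t * p z)" for x
  have low: "- p (- x) \<le> p (x + t *\<^sub>R z) - t * p z" if "t \<ge> 0" for x t
    using sublinear_add[OF p, of "x + t *\<^sub>R z" "- x"] that by (simp add: sublinear_scale[OF p])
  have qle: "q x \<le> p (x + t *\<^sub>R z) - t * p z" if "t \<ge> 0" for x t
    unfolding q_def using that low
    by (intro cINF_lower) (auto intro!: bdd_belowI2[where m = "- p (- x)"])
  have qge: "c \<le> q x" if "\<And>t. t \<ge> 0 \<Longrightarrow> c \<le> p (x + t *\<^sub>R z) - t * p z" for c x
    unfolding q_def using that by (intro cINF_greatest) auto
  show "q x \<le> p x" for x using qle[of 0 x] by simp
  show "q x \<le> p (x + z) - p z" for x using qle[of 1 x] by simp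
  show "sublinear q"
  proof (rule sublinearI)
    fix x y
    have *: "q (x + y) \<le> (p (x + s *\<^sub>R z) - s * p z) + (p (y + t *\<^sub>R z) - t * p z)"
      if "s \<ge> 0" "t \<ge> 0" for s t
      using qle[of "s + t" "x + y"] that
        sublinear_add[OF p, of "x + s *\<^sub>R z" "y + t *\<^sub>R z"]
      by (simp add: algebra_simps)
    have "q (x + y) - (p (x + s *\<^sub>R z) - s * p z) \<le> q y" if "s \<ge> 0" for s
    proof (rule qge)
      fix t :: real assume "t \<ge> 0"
      from *[OF that this] show "q (x + y) - (p (x + s *\<^sub>R z) - s * p z) \<le> p (y + t *\<^sub>R z) - t * p z"
        by simp
    qed
    then have "q (x + y) - q y \<le> q x"
      by (intro qge) (simp add: algebra_simps)
    then show "q (x + y) \<le> q x + q y" by simp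
  next
    show "q 0 = 0"
      by (rule antisym) (use qle[of 0 0] sublinear_0[OF p] in simp,
        rule qge, simp add: sublinear_scale[OF p])
  next
    fix r :: real and x assume r: "0 < r"
    have "q (r *\<^sub>R x) / r \<le> p (x + t *\<^sub>R z) - t * p z" if "t \<ge> 0" for t
      unfolding pos_divide_le_eq[OF r]
      using qle[of "r * t" "r *\<^sub>R x"] that r sublinear_scale[OF p, of r "x + t *\<^sub>R z"]
      by (simp add: algebra_simps)
    then have "q (r *\<^sub>R x) / r \<le> q x" by (rule qge)
    then show "q (r *\<^sub>R x) \<le> r * q x" using r by (simp add: pos_divide_le_eq mult.commute)
  qed
qed

lemma minimal_sublinear_is_linear:
  fixes q :: "'a::real_vector \<Rightarrow> real"
  assumes q: "sublinear q" and minimal: "\<And>q'. sublinear q' \<Longrightarrow> (\<And>x. q' x \<le> q x) \<Longrightarrow> q' = q"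
  shows "linear q"
proof -
  have "q x + q z \<le> q (x + z)" for x z
  proof -
    obtain q' where q': "sublinear q'" "\<And>x. q' x \<le> q x" "\<And>x. q' x \<le> q (x + z) - q z"
      using sublinear_decrease[OF q, of z] by blast
    with minimal[of q'] have "q' = q" by blast
    with q'(3)[of x] show ?thesis by simp
  qed
  then have add: "q (x + y) = q x + q y" for x y
    using sublinear_add[OF q] by (simp add: antisym)
  have minus: "q (- x) = - q x" for x
    using add[of x "- x"] by (simp add: sublinear_0[OF q])
  have "q (r *\<^sub>R x) = r * q x" for r x
  proof (cases "r \<ge> 0")
    case False
    then show ?thesis
      using sublinear_scale[OF q, of "- r" x] minus[of "r *\<^sub>R x"] by simp
  qed (simp add: sublinear_scale[OF q])
  with add show ?thesis by (intro linearI) simp_all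
qed

text \<open>By Zorn's lemma: the pointwise infimum of a chain is again sublinear, and it is finite because
  every sublinear \<open>q \<le> p\<close> satisfies \<open>q x \<ge> - p (- x)\<close>.\<close>

lemma exists_minimal_sublinear:
  fixes p :: "'a::real_vector \<Rightarrow> real"
  assumes p: "sublinear p"
  obtains q where "sublinear q" "\<And>x. q x \<le> p x"
    "\<And>q'. sublinear q' \<Longrightarrow> (\<And>x. q' x \<le> q x) \<Longrightarrow> q' = q"
proof -
  define A where "A = {q. sublinear q \<and> (\<forall>x. q x \<le> p x)}"
  define R where "R a b \<longleftrightarrow> (\<forall>x. b x \<le> a x)" for a b :: "'a \<Rightarrow> real"
  have "\<exists>m\<in>A. \<forall>a\<in>A. R m a \<longrightarrow> a = m"
  proof (rule predicate_Zorn)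
    show "partial_order_on A (relation_of R A)"
      by (rule partial_order_on_relation_ofI)
        (auto simp: R_def fun_eq_iff intro: order_trans antisym)
  next
    fix C assume "C \<in> Chains (relation_of R A)"
    then have CA: "C \<subseteq> A" and total: "\<And>a b. a \<in> C \<Longrightarrow> b \<in> C \<Longrightarrow> R a b \<or> R b a"
      by (auto simp: Chains_def relation_of_def)
    show "\<exists>u\<in>A. \<forall>a\<in>C. R a u"
    proof (cases "C = {}")
      case True
      then show ?thesis using p by (auto simp: A_def)
    next
      case False
      define u where "u x = (INF q\<in>C. q x)" for x
      have C: "sublinear q" "q x \<le> p x" if "q \<in> C" for q x
        using that CA by (auto simp: A_def)
      have "- p (- x) \<le> q x" if "q \<in> C" for q x
        using sublinear_minus[OF C(1)[OF that], of x] C(2)[OF that, of "- x"] by simp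
      then have ule: "u x \<le> q x" if "q \<in> C" for q x
        unfolding u_def using that
        by (intro cINF_lower) (auto intro!: bdd_belowI2[where m = "- p (- x)"])
      have uge: "c \<le> u x" if "\<And>q. q \<in> C \<Longrightarrow> c \<le> q x" for c x
        unfolding u_def using that False by (intro cINF_greatest) auto
      have "sublinear u"
      proof (rule sublinearI)
        fix x y
        have *: "u (x + y) \<le> a x + b y" if ab: "a \<in> C" "b \<in> C" for a b
        proof (cases "R a b")
          case True
          then show ?thesis
            using ule[OF ab(2), of "x + y"] sublinear_add[OF C(1)[OF ab(2)], of x y]
            by (auto simp: R_def dest: spec[of _ x])
        next
          case False
          then have "R b a" using total ab by blast
          then show ?thesis
            using ule[OF ab(1), of "x + y"] sublinear_add[OF C(1)[OF ab(1)], of x y]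
            by (auto simp: R_def dest: spec[of _ y])
        qed
        have "u (x + y) - a x \<le> u y" if "a \<in> C" for a
        proof (rule uge)
          fix b assume "b \<in> C"
          from *[OF that this] show "u (x + y) - a x \<le> b y" by simp
        qed
        then have "u (x + y) - u y \<le> u x"
          by (intro uge) (simp add: algebra_simps)
        then show "u (x + y) \<le> u x + u y" by simp
      next
        show "u 0 = 0"
          using False C(1) by (auto simp: u_def sublinear_0)
      next
        fix r :: real and x assume r: "0 < r"
        have "u (r *\<^sub>R x) / r \<le> q x" if "q \<in> C" for q
          using ule[OF that, of "r *\<^sub>R x"] r sublinear_scale[OF C(1)[OF that], of r x]
          by (simp add: pos_divide_le_eq mult.commute)
        then have "u (r *\<^sub>R x) / r \<le> u x" by (rule uge)
        then show "u (r *\<^sub>R x) \<le> r * u x" using r by (simp add: pos_divide_le_eq mult.commute)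
      qed
      moreover have "u x \<le> p x" for x
        using False ule C(2) by (meson all_not_in_conv order_trans)
      ultimately show ?thesis
        using ule by (auto simp: A_def R_def)
    qed
  qed
  then obtain q where q: "q \<in> A" "\<And>a. a \<in> A \<Longrightarrow> R q a \<Longrightarrow> a = q" by blast
  show ?thesis
  proof
    show "sublinear q" "q x \<le> p x" for x using q(1) by (auto simp: A_def)
    show "q' = q" if "sublinear q'" "\<And>x. q' x \<le> q x" for q'
    proof (rule q(2))
      show "q' \<in> A"
        using that q(1) by (auto simp: A_def intro: order_trans)
      show "R q q'" using that(2) by (simp add: R_def)
    qed
  qed
qed

text \<open>It suffices to find a linear functional below the decreased functional of \<open>sublinear_decrease\<close>,
  and every minimal sublinear functional below that one is linear.\<close>

theorem Hahn_Banach_sublinear: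
  fixes p :: "'a::real_vector \<Rightarrow> real"
  assumes p: "sublinear p"
  obtains u where "linear u" "\<And>x. u x \<le> p x" "u z = p z"
proof -
  obtain p1 where p1: "sublinear p1" "\<And>x. p1 x \<le> p x" "\<And>x. p1 x \<le> p (x + z) - p z"
    using sublinear_decrease[OF p, of z] by blast
  obtain u where u: "sublinear u" "\<And>x. u x \<le> p1 x"
      "\<And>q'. sublinear q' \<Longrightarrow> (\<And>x. q' x \<le> u x) \<Longrightarrow> q' = u"
    using exists_minimal_sublinear[OF p1(1)] by blast
  have lin: "linear u" by (rule minimal_sublinear_is_linear[OF u(1,3)])
  have le: "u x \<le> p x" for x using u(2) p1(2) order_trans by blast
  have "- u z \<le> - p z"
    using u(2)[of "- z"] p1(3)[of "- z"] sublinear_0[OF p] linear_neg[OF lin, of z] by simp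
  then have "u z = p z" using le[of z] by simp
  with lin le show ?thesis by (rule that)
qed

section \<open>Functionals that annihilate a closed subspace\<close>

lemma sublinear_infdist_subspace:
  fixes J :: "'a::real_normed_vector set"
  assumes J: "subspace J"
  shows "sublinear (\<lambda>x. infdist x J)"
proof -
  have ne: "J \<noteq> {}" using subspace_0[OF J] by blast
  have le: "infdist x J \<le> norm (x - j)" if "j \<in> J" for x j
    using infdist_le[OF that, of x] by (simp add: dist_norm)
  have ge: "c \<le> infdist x J" if "\<And>j. j \<in> J \<Longrightarrow> c \<le> norm (x - j)" for c x
    unfolding infdist_notempty[OF ne] using ne that by (intro cINF_greatest) (auto simp: dist_norm)
  show ?thesis
  proof (rule sublinearI)
    fix x y
    have "infdist (x + y) J \<le> norm (x - j) + norm (y - k)" if "j \<in> J" "k \<in> J" for j k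
    proof -
      have "infdist (x + y) J \<le> norm ((x - j) + (y - k))"
        using le[OF subspace_add[OF J that], of "x + y"] by (simp add: algebra_simps)
      also have "\<dots> \<le> norm (x - j) + norm (y - k)" by (rule norm_triangle_ineq)
      finally show ?thesis .
    qed
    then have "infdist (x + y) J - norm (x - j) \<le> infdist y J" if "j \<in> J" for j
      using that by (intro ge) (simp add: algebra_simps)
    then have "infdist (x + y) J - infdist y J \<le> infdist x J"
      by (intro ge) (simp add: algebra_simps)
    then show "infdist (x + y) J \<le> infdist x J + infdist y J" by simp
  next
    show "infdist 0 J = 0" using subspace_0[OF J] by simp
  next
    fix r :: real and x :: 'a assume r: "0 < r"
    have "infdist (r *\<^sub>R x) J / r \<le> norm (x - j)" if "j \<in> J" for j
    proof -
      have "infdist (r *\<^sub>R x) J \<le> norm (r *\<^sub>R (x - j))"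
        using le[OF subspace_scale[OF J that], of "r *\<^sub>R x" r] by (simp add: algebra_simps)
      then show ?thesis using r by (simp add: pos_divide_le_eq mult.commute)
    qed
    then have "infdist (r *\<^sub>R x) J / r \<le> infdist x J" by (rule ge)
    then show "infdist (r *\<^sub>R x) J \<le> r * infdist x J"
      using r by (simp add: pos_divide_le_eq mult.commute)
  qed
qed

text \<open>The distance from \<open>J\<close> is a sublinear functional that is zero on \<open>J\<close>, positive at \<open>f\<close> and
  bounded by the norm; a linear functional below it with the same value at \<open>f\<close> is as required.\<close>

lemma separate_from_closed_subspace:
  fixes J :: "'a::real_normed_vector set"
  assumes J: "subspace J" "closed J" and f: "f \<notin> J"
  obtains u :: "'a \<Rightarrow> real" where "bounded_linear u" "\<And>x. x \<in> J \<Longrightarrow> u x = 0" "u f \<noteq> 0"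
proof -
  obtain u where u: "linear u" "\<And>x. u x \<le> infdist x J" "u f = infdist f J"
    using Hahn_Banach_sublinear[OF sublinear_infdist_subspace[OF J(1)]] by blast
  have abs: "\<bar>u x\<bar> \<le> max (infdist x J) (infdist (- x) J)" for x
    using u(2)[of x] u(2)[of "- x"] linear_neg[OF u(1), of x] by simp
  show ?thesis
  proof
    have "infdist x J \<le> norm x" for x
      using infdist_le[OF subspace_0[OF J(1)], of x] by simp
    from this[of "- _"] this have "norm (u x) \<le> norm x * 1" for x
      using abs[of x] by (metis max.bounded_iff mult.right_neutral norm_minus_cancel order_trans real_norm_def)
    then show "bounded_linear u"
      using u(1) by (intro bounded_linear_intro[where K = 1]) (auto simp: linear_add linear_scale)
    show "u x = 0" if "x \<in> J" for x
      using abs[of x] that subspace_neg[OF J(1) that] by simp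
    show "u f \<noteq> 0"
      using u(3) infdist_pos_not_in_closed[OF J(2) _ f] subspace_0[OF J(1)] by force
  qed
qed

lemma vector_space_mult: "vector_space ((*) :: 'k::field \<Rightarrow> 'k \<Rightarrow> 'k)"
  by unfold_locales (auto simp: algebra_simps)

lemma bounded_linear_if_continuous_linear:
  fixes f :: "'a::real_normed_vector \<Rightarrow> 'b::real_normed_vector"
  assumes lin: "linear f" and cont: "continuous_on UNIV f"
  shows "bounded_linear f"
proof -
  have "continuous (at 0) f"
    using cont by (simp add: continuous_on_eq_continuous_at)
  then obtain d where d: "d > 0" "\<And>x. norm x < d \<Longrightarrow> norm (f x) < 1"
    using linear_0[OF lin]
    by (auto simp: continuous_at_eps_delta dest!: spec[of _ 1])
  have "norm (f x) \<le> norm x * (2 / d)" for x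
  proof (cases "x = 0")
    case False
    \<comment> \<open>Scaling \<open>x\<close> to norm \<open>d / 2\<close> brings it into the ball on which \<open>f\<close> is bounded by 1.\<close>
    define r where "r = d / (2 * norm x)"
    have r: "r > 0" using d(1) False by (simp add: r_def)
    have "norm (r *\<^sub>R x) < d" using d(1) False by (simp add: r_def)
    then have "norm (f (r *\<^sub>R x)) < 1" by (rule d(2))
    then have "r * norm (f x) < 1" using r by (simp add: linear_scale[OF lin])
    then show ?thesis using d(1) False by (simp add: r_def field_simps)
  qed (simp add: linear_0[OF lin])
  then show ?thesis
    by (rule bounded_linear_intro[rotated 2]) (simp_all add: lin linear_add linear_scale)
qed

lemma dual_space_iff:
  fixes s :: "'k::real_normed_field \<Rightarrow> 'x::banach \<Rightarrow> 'x"
  assumes s: "vector_space s" "\<And>r x. s (of_real r) x = r *\<^sub>R x"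
  shows "\<phi> \<in> dual_space s \<longleftrightarrow> bounded_linear \<phi> \<and> (\<forall>c x. \<phi> (s c x) = c * \<phi> x)"
proof
  assume "\<phi> \<in> dual_space s"
  then have add: "\<And>x y. \<phi> (x + y) = \<phi> x + \<phi> y" and scale: "\<And>c x. \<phi> (s c x) = c * \<phi> x"
    and cont: "continuous_on UNIV \<phi>"
    by (auto simp: dual_space_def Vector_Spaces.linear_iff)
  have "linear \<phi>"
    using scale[of "of_real _"] add
    by (intro linearI) (auto simp: s(2) scaleR_conv_of_real)
  with cont scale show "bounded_linear \<phi> \<and> (\<forall>c x. \<phi> (s c x) = c * \<phi> x)"
    using bounded_linear_if_continuous_linear by blast
next
  assume "bounded_linear \<phi> \<and> (\<forall>c x. \<phi> (s c x) = c * \<phi> x)"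
  then show "\<phi> \<in> dual_space s"
    by (auto simp: dual_space_def Vector_Spaces.linear_iff s(1) vector_space_mult linear_continuous_on
        dest: bounded_linear.linear linear_add)
qed

lemma dual_space_bcf:
  fixes \<phi> :: "('a::metric_space \<Rightarrow>\<^sub>C 'k::{real_normed_field,banach}) \<Rightarrow> 'k"
  shows "\<phi> \<in> dual_space bcf_scale \<longleftrightarrow> bounded_linear \<phi> \<and> (\<forall>c f. \<phi> (bcf_scale c f) = c * \<phi> f)"
  by (rule dual_space_iff[OF vector_space_bcf_scale bcf_scale_of_real])

lemma subspace_if_bcf_scale_subspace:
  fixes J :: "('a::topological_space \<Rightarrow>\<^sub>C 'k::real_normed_field) set"
  assumes "module.subspace bcf_scale J"
  shows "subspace J"
proof -
  interpret V: vector_space "bcf_scale :: 'k \<Rightarrow> ('a \<Rightarrow>\<^sub>C 'k) \<Rightarrow> _"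
    by (rule vector_space_bcf_scale)
  show ?thesis
    using V.subspace_0[OF assms] V.subspace_add[OF assms] V.subspace_scale[OF assms, of _ "of_real _"]
    by (intro subspaceI) (auto simp: bcf_scale_of_real)
qed

lemma real_annihilator_separates:
  fixes J :: "('a::metric_space \<Rightarrow>\<^sub>C real) set"
  assumes J: "module.subspace bcf_scale J" "closed J" and f: "f \<notin> J"
  obtains \<phi> where "\<phi> \<in> annihilator bcf_scale J" "\<phi> f \<noteq> 0"
proof -
  have scale: "bcf_scale r g = r *\<^sub>R g" for r :: real and g :: "'a \<Rightarrow>\<^sub>C real"
    using bcf_scale_of_real[of r g] by simp
  obtain u :: "_ \<Rightarrow> real" where u: "bounded_linear u" "\<And>x. x \<in> J \<Longrightarrow> u x = 0" "u f \<noteq> 0"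
    using separate_from_closed_subspace[OF subspace_if_bcf_scale_subspace[OF J(1)] J(2) f] by blast
  from u(1,2) have "u \<in> annihilator bcf_scale J"
    by (auto simp: annihilator_def dual_space_bcf scale linear_scale bounded_linear.linear)
  with u(3) show ?thesis by (rule that[rotated])
qed

text \<open>A real functional \<open>u\<close> is the real part of the complex functional \<open>g \<mapsto> u g - \<i> u (\<i> g)\<close>.\<close>

lemma complex_annihilator_separates:
  fixes J :: "('a::metric_space \<Rightarrow>\<^sub>C complex) set"
  assumes J: "module.subspace bcf_scale J" "closed J" and f: "f \<notin> J"
  obtains \<phi> where "\<phi> \<in> annihilator bcf_scale J" "\<phi> f \<noteq> 0"
proof -
  interpret V: vector_space "bcf_scale :: complex \<Rightarrow> ('a \<Rightarrow>\<^sub>C complex) \<Rightarrow> _"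
    by (rule vector_space_bcf_scale)
  obtain u :: "_ \<Rightarrow> real" where u: "bounded_linear u" "\<And>x. x \<in> J \<Longrightarrow> u x = 0" "u f \<noteq> 0"
    using separate_from_closed_subspace[OF subspace_if_bcf_scale_subspace[OF J(1)] J(2) f] by blast
  define \<phi> where "\<phi> g = Complex (u g) (- u (bcf_scale \<i> g))" for g
  have lin: "u (g + g') = u g + u g'" "u (r *\<^sub>R g) = r * u g" for g g' r
    using u(1) by (auto simp: linear_add linear_scale bounded_linear.linear)
  \<comment> \<open>Complex homogeneity of \<open>\<phi>\<close> reduces to real linearity of \<open>u\<close> by splitting the scalar.\<close>
  have split: "bcf_scale c g = Re c *\<^sub>R g + Im c *\<^sub>R bcf_scale \<i> g" for c and g :: "'a \<Rightarrow>\<^sub>C complex"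
    by (rule bcontfun_eqI) (simp add: complex_eq_iff)
  have "bounded_linear (bcf_scale \<i> :: ('a \<Rightarrow>\<^sub>C complex) \<Rightarrow> _)"
  proof (rule bounded_linear_intro)
    show "norm (bcf_scale \<i> g) \<le> norm g * 1" for g :: "'a \<Rightarrow>\<^sub>C complex"
      by (rule norm_bound) (simp add: norm_mult norm_bounded)
  qed (auto intro!: bcontfun_eqI simp: algebra_simps)
  then have "bounded_linear (\<lambda>g. u (bcf_scale \<i> g))"
    by (rule bounded_linear_compose[OF u(1)])
  then have bl: "bounded_linear \<phi>"
    unfolding \<phi>_def Complex_eq
    by (intro bounded_linear_add bounded_linear_const_mult bounded_linear_minus
        bounded_linear_compose[OF bounded_linear_of_real] u(1))
  have "\<phi> (bcf_scale c g) = c * \<phi> g" for c g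
  proof -
    have "bcf_scale \<i> (bcf_scale c g) = Re c *\<^sub>R bcf_scale \<i> g + (- Im c) *\<^sub>R g"
      by (rule bcontfun_eqI) (simp add: complex_eq_iff)
    then have "u (bcf_scale \<i> (bcf_scale c g)) = Re c * u (bcf_scale \<i> g) - Im c * u g"
      by (simp only: lin)
    moreover have "u (bcf_scale c g) = Re c * u g + Im c * u (bcf_scale \<i> g)"
      by (subst split) (simp only: lin)
    ultimately show ?thesis
      by (simp add: \<phi>_def complex_eq_iff)
  qed
  with bl u(2) V.subspace_scale[OF J(1)] have "\<phi> \<in> annihilator bcf_scale J"
    by (auto simp: annihilator_def dual_space_bcf \<phi>_def zero_complex.code)
  moreover have "\<phi> f \<noteq> 0" using u(3) by (simp add: \<phi>_def complex_eq_iff)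
  ultimately show ?thesis by (rule that)
qed

section \<open>M-ideals are invariant under multiplication by functions\<close>

text \<open>Since \<open>P\<close> fixes \<open>\<phi> + \<psi>\<close>, the norm of this sum is at most \<open>\<parallel>P \<phi>\<parallel> + \<parallel>P \<psi>\<parallel>\<close>. By the norm condition
  on \<open>P\<close>, that is \<open>\<parallel>\<phi>\<parallel> + \<parallel>\<psi>\<parallel>\<close> minus \<open>\<parallel>\<phi> - P \<phi>\<parallel> + \<parallel>\<psi> - P \<psi>\<parallel>\<close>, so the last two norms are zero.\<close>

lemma L_summand_hereditary:
  fixes s :: "'k::real_normed_field \<Rightarrow> 'x::banach \<Rightarrow> 'x"
  assumes s: "vector_space s" "\<And>r x. s (of_real r) x = r *\<^sub>R x"
    and Y: "dual_L_summand s Y"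
    and \<phi>: "\<phi> \<in> dual_space s" and \<psi>: "\<psi> \<in> dual_space s"
    and sum: "(\<lambda>x. \<phi> x + \<psi> x) \<in> Y"
    and norms: "onorm \<phi> + onorm \<psi> \<le> onorm (\<lambda>x. \<phi> x + \<psi> x)"
  shows "\<phi> \<in> Y"
proof -
  obtain P where P: "dual_projection_onto s Y P" and Y_dual: "Y \<subseteq> dual_space s"
    and L: "\<And>\<phi>. \<phi> \<in> dual_space s \<Longrightarrow> onorm \<phi> = onorm (P \<phi>) + onorm (\<lambda>x. \<phi> x - P \<phi> x)"
    using Y unfolding dual_L_summand_def by blast
  have P_Y: "P \<theta> \<in> Y" if "\<theta> \<in> dual_space s" for \<theta>
    using P that by (auto simp: dual_projection_onto_def)
  have P_fix: "P \<theta> = \<theta>" if "\<theta> \<in> Y" for \<theta>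
    using P that by (auto simp: dual_projection_onto_def)
  have P_add: "P (\<lambda>x. \<phi> x + \<psi> x) = (\<lambda>x. P \<phi> x + P \<psi> x)"
    using P \<phi> \<psi> by (auto simp: dual_projection_onto_def)
  have bl: "bounded_linear \<theta>" if "\<theta> \<in> dual_space s" for \<theta>
    using that dual_space_iff[OF s] by blast
  have bl_P: "bounded_linear (P \<theta>)" if "\<theta> \<in> dual_space s" for \<theta>
    using that P_Y Y_dual bl by blast
  have bl_diff: "bounded_linear (\<lambda>x. \<theta> x - P \<theta> x)" if "\<theta> \<in> dual_space s" for \<theta>
    using that by (intro bounded_linear_sub bl bl_P)
  have "onorm (\<lambda>x. \<phi> x + \<psi> x) = onorm (\<lambda>x. P \<phi> x + P \<psi> x)"
    using P_fix[OF sum] P_add by simp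
  also have "\<dots> \<le> onorm (P \<phi>) + onorm (P \<psi>)"
    using \<phi> \<psi> by (intro onorm_triangle bl_P)
  finally have "onorm (\<lambda>x. \<phi> x - P \<phi> x) + onorm (\<lambda>x. \<psi> x - P \<psi> x) \<le> 0"
    using norms L[OF \<phi>] L[OF \<psi>] by simp
  then have "onorm (\<lambda>x. \<phi> x - P \<phi> x) = 0"
    using onorm_pos_le[OF bl_diff[OF \<phi>]] onorm_pos_le[OF bl_diff[OF \<psi>]] by simp
  then have "P \<phi> = \<phi>"
    using onorm_eq_0[OF bl_diff[OF \<phi>]] by (auto simp: fun_eq_iff)
  with P_Y[OF \<phi>] show ?thesis by simp
qed

definition modulate ::
    "('a::topological_space \<Rightarrow>\<^sub>C real) \<Rightarrow> ('a \<Rightarrow>\<^sub>C 'b::real_normed_vector) \<Rightarrow> ('a \<Rightarrow>\<^sub>C 'b)"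
  where "modulate h f = Bcontfun (\<lambda>x. apply_bcontfun h x *\<^sub>R apply_bcontfun f x)"

lemma apply_modulate [simp]:
  "apply_bcontfun (modulate h f) x = apply_bcontfun h x *\<^sub>R apply_bcontfun f x"
proof -
  have "(\<lambda>x. apply_bcontfun h x *\<^sub>R apply_bcontfun f x) \<in> bcontfun"
  proof (rule bcontfun_normI)
    show "norm (apply_bcontfun h x *\<^sub>R apply_bcontfun f x) \<le> norm h * norm f" for x
      using norm_bounded[of h x] norm_bounded[of f x] by (simp add: mult_mono)
  qed (intro continuous_intros continuous_on_apply_bcontfun)
  then show ?thesis by (simp add: modulate_def Bcontfun_inverse)
qed

lemma bounded_linear_modulate: "bounded_linear (modulate h)"
proof (rule bounded_linear_intro)
  show "norm (modulate h f) \<le> norm f * norm h" for f :: "'a \<Rightarrow>\<^sub>C 'b"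
  proof (rule norm_bound)
    show "norm (apply_bcontfun (modulate h f) x) \<le> norm f * norm h" for x
      using norm_bounded[of h x] norm_bounded[of f x]
      by (simp add: mult_mono mult.commute[of "norm f"])
  qed
qed (auto intro!: bcontfun_eqI simp: algebra_simps)

lemma unimodular_rotation:
  fixes z :: "'k::real_normed_field"
  obtains c where "norm c = 1" "c * z = of_real (norm z)"
proof (cases "z = 0")
  case False
  then show ?thesis
    by (intro that[of "of_real (norm z) / z"]) (auto simp: norm_divide)
qed (use that[of 1] in simp)

lemma modulate_dual_space:
  fixes \<phi> :: "('a::metric_space \<Rightarrow>\<^sub>C 'k::{real_normed_field,banach}) \<Rightarrow> 'k"
  assumes "\<phi> \<in> dual_space bcf_scale"
  shows "(\<lambda>f. \<phi> (modulate h f)) \<in> dual_space bcf_scale"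
proof -
  have "modulate h (bcf_scale c f) = bcf_scale c (modulate h f)" for c and f :: "'a \<Rightarrow>\<^sub>C 'k"
    by (rule bcontfun_eqI) simp
  then show ?thesis
    using assms by (auto simp: dual_space_bcf intro: bounded_linear_compose bounded_linear_modulate)
qed

lemma onorm_modulate_le:
  fixes \<phi> :: "('a::topological_space \<Rightarrow>\<^sub>C 'b::real_normed_vector) \<Rightarrow> 'c::real_normed_vector"
  assumes \<phi>: "bounded_linear \<phi>"
    and h: "\<And>x. 0 \<le> apply_bcontfun h x" "\<And>x. apply_bcontfun h x \<le> 1"
  shows "onorm (\<lambda>f. \<phi> (modulate h f)) \<le> onorm \<phi>"
proof (rule onorm_bound)
  fix f :: "'a \<Rightarrow>\<^sub>C 'b"
  have "norm (modulate h f) \<le> norm f"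
  proof (rule norm_bound)
    show "norm (apply_bcontfun (modulate h f) x) \<le> norm f" for x
      using mult_mono[OF h(2)[of x] norm_bounded[of f x]] h(1)[of x] by simp
  qed
  then show "norm (\<phi> (modulate h f)) \<le> onorm \<phi> * norm f"
    using onorm[OF \<phi>, of "modulate h f"] onorm_pos_le[OF \<phi>]
    by (meson mult_left_mono order_trans)
qed (rule onorm_pos_le[OF \<phi>])

text \<open>If \<open>f\<close> and \<open>g\<close> are in the unit ball, then so is \<open>c h f + d k g\<close> for scalars \<open>c\<close> and \<open>d\<close> of
  modulus one, as its values are bounded by convex combinations of \<open>\<bar>f\<bar>\<close> and \<open>\<bar>g\<bar>\<close>. With \<open>c\<close> and
  \<open>d\<close> chosen such that both terms of \<open>\<phi> (c h f) + \<phi> (d k g)\<close> are nonnegative, this gives \<open>\<bar>\<phi> (h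
  f)\<bar> + \<bar>\<phi> (k g)\<bar> \<le> \<parallel>\<phi>\<parallel>\<close>, and the suprema over \<open>f\<close> and \<open>g\<close> can be taken independently.\<close>

lemma onorm_modulate_split:
  fixes \<phi> :: "('a::metric_space \<Rightarrow>\<^sub>C 'k::{real_normed_field,banach}) \<Rightarrow> 'k"
    and h k :: "'a \<Rightarrow>\<^sub>C real"
  assumes \<phi>: "\<phi> \<in> dual_space bcf_scale"
    and h: "\<And>x. 0 \<le> apply_bcontfun h x" and k: "\<And>x. 0 \<le> apply_bcontfun k x"
    and hk: "\<And>x. apply_bcontfun h x + apply_bcontfun k x = 1"
  shows "onorm (\<lambda>f. \<phi> (modulate h f)) + onorm (\<lambda>f. \<phi> (modulate k f)) \<le> onorm \<phi>"
proof -
  have bl: "bounded_linear \<phi>" and scale: "\<And>c f. \<phi> (bcf_scale c f) = c * \<phi> f"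
    using \<phi> by (auto simp: dual_space_bcf)
  \<comment> \<open>The estimate for the unit ball, in homogeneous form.\<close>
  have *: "norm (\<phi> (modulate h f)) * norm g + norm (\<phi> (modulate k g)) * norm f
      \<le> onorm \<phi> * (norm f * norm g)" for f g
  proof -
    obtain c where c: "norm c = 1" "c * \<phi> (modulate h f) = of_real (norm (\<phi> (modulate h f)))"
      by (rule unimodular_rotation)
    obtain d where d: "norm d = 1" "d * \<phi> (modulate k g) = of_real (norm (\<phi> (modulate k g)))"
      by (rule unimodular_rotation)
    define F where "F = norm g *\<^sub>R bcf_scale c (modulate h f) + norm f *\<^sub>R bcf_scale d (modulate k g)"
    have "norm F \<le> norm f * norm g"
    proof (rule norm_bound)
      fix x
      have "norm (apply_bcontfun F x) \<le>
          norm g * (apply_bcontfun h x * norm (apply_bcontfun f x)) +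
          norm f * (apply_bcontfun k x * norm (apply_bcontfun g x))"
        unfolding F_def using h[of x] k[of x] c(1) d(1)
        by (auto intro!: norm_triangle_le simp: norm_mult)
      also have "\<dots> \<le> norm g * (apply_bcontfun h x * norm f) + norm f * (apply_bcontfun k x * norm g)"
        by (intro add_mono mult_left_mono norm_bounded h k norm_ge_zero)
      also have "\<dots> = (apply_bcontfun h x + apply_bcontfun k x) * (norm f * norm g)"
        by (simp add: algebra_simps)
      finally show "norm (apply_bcontfun F x) \<le> norm f * norm g" by (simp add: hk)
    qed
    then have "onorm \<phi> * norm F \<le> onorm \<phi> * (norm f * norm g)"
      by (intro mult_left_mono onorm_pos_le bl)
    moreover have "norm (\<phi> F) \<le> onorm \<phi> * norm F" by (rule onorm[OF bl])
    moreover have "\<phi> F = of_real (norm (\<phi> (modulate h f)) * norm g + norm (\<phi> (modulate k g)) * norm f)"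
      unfolding F_def
      by (simp add: linear_add linear_scale bounded_linear.linear[OF bl] scale c(2) d(2)
          scaleR_conv_of_real mult.commute)
    ultimately show ?thesis by (simp add: norm_of_real del: of_real_add of_real_mult)
  qed
  have h1: "apply_bcontfun h x \<le> 1" and k1: "apply_bcontfun k x \<le> 1" for x
    using h[of x] k[of x] hk[of x] by simp_all
  define A where "A = onorm (\<lambda>f. \<phi> (modulate h f))"
  define B where "B = onorm (\<lambda>f. \<phi> (modulate k f))"
  have "A \<le> onorm \<phi> - norm (\<phi> (modulate k g)) / norm g" if "g \<noteq> 0" for g
    unfolding A_def
  proof (rule onorm_bound)
    have "norm g > 0" using that by simp
    show "norm (\<phi> (modulate h f)) \<le> (onorm \<phi> - norm (\<phi> (modulate k g)) / norm g) * norm f" for f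
      using *[of f g] \<open>norm g > 0\<close> by (simp add: field_simps)
    have "norm (\<phi> (modulate k g)) / norm g \<le> onorm (\<lambda>f. \<phi> (modulate k f))"
      by (intro le_onorm bounded_linear_compose[OF bl bounded_linear_modulate])
    also have "\<dots> \<le> onorm \<phi>" by (rule onorm_modulate_le[OF bl k k1])
    finally show "0 \<le> onorm \<phi> - norm (\<phi> (modulate k g)) / norm g" by simp
  qed
  then have le: "norm (\<phi> (modulate k g)) \<le> (onorm \<phi> - A) * norm g" for g
    using linear_0[OF bounded_linear.linear[OF bounded_linear_compose[OF bl bounded_linear_modulate]]]
    by (cases "g = 0") (auto simp: field_simps)
  have "0 \<le> onorm \<phi> - A"
    unfolding A_def using onorm_modulate_le[OF bl h h1] by simp
  then have "B \<le> onorm \<phi> - A"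
    unfolding B_def using le by (rule onorm_bound)
  then show ?thesis by (simp add: A_def B_def)
qed

text \<open>By duality: if \<open>\<phi>\<close> annihilates \<open>J\<close>, then so does \<open>\<phi> (h \<cdot>)\<close>, because \<open>\<phi>\<close> is the norm-additive
  sum of \<open>\<phi> (h \<cdot>)\<close> and \<open>\<phi> ((1 - h) \<cdot>)\<close> and the annihilator is an L-summand. That annihilators
  separate points from \<open>J\<close> is an assumption here so that both scalar fields are covered.\<close>

lemma M_ideal_modulate_closed:
  fixes J :: "('a::metric_space \<Rightarrow>\<^sub>C 'k::{real_normed_field,banach}) set"
  assumes J: "M_ideal bcf_scale J"
    and separates: "\<And>f. f \<notin> J \<Longrightarrow> \<exists>\<phi>\<in>annihilator bcf_scale J. \<phi> f \<noteq> 0"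
    and h: "\<And>x. 0 \<le> apply_bcontfun h x" "\<And>x. apply_bcontfun h x \<le> 1"
    and f: "f \<in> J"
  shows "modulate h f \<in> J"
proof (rule ccontr)
  assume "modulate h f \<notin> J"
  then obtain \<phi> where \<phi>: "\<phi> \<in> annihilator bcf_scale J" "\<phi> (modulate h f) \<noteq> 0"
    using separates by blast
  then have dual: "\<phi> \<in> dual_space bcf_scale" by (simp add: annihilator_def)
  then have lin: "linear \<phi>" by (simp add: dual_space_bcf bounded_linear.linear)
  define k where "k = const_bcontfun 1 - h"
  have k: "apply_bcontfun k x = 1 - apply_bcontfun h x" for x by (simp add: k_def)
  have "modulate h g + modulate k g = g" for g :: "'a \<Rightarrow>\<^sub>C 'k"
    by (rule bcontfun_eqI) (simp add: k algebra_simps)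
  then have sum: "(\<lambda>g. \<phi> (modulate h g) + \<phi> (modulate k g)) = \<phi>"
    by (simp flip: linear_add[OF lin])
  have "(\<lambda>g. \<phi> (modulate h g)) \<in> annihilator bcf_scale J"
  proof (rule L_summand_hereditary[OF vector_space_bcf_scale bcf_scale_of_real])
    show "dual_L_summand bcf_scale (annihilator bcf_scale J)"
      using J by (simp add: M_ideal_def)
    show "onorm (\<lambda>g. \<phi> (modulate h g)) + onorm (\<lambda>g. \<phi> (modulate k g))
        \<le> onorm (\<lambda>g. \<phi> (modulate h g) + \<phi> (modulate k g))"
      unfolding sum by (rule onorm_modulate_split[OF dual]) (simp_all add: h k)
    show "(\<lambda>g. \<phi> (modulate h g) + \<phi> (modulate k g)) \<in> annihilator bcf_scale J"
      unfolding sum by (rule \<phi>(1))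
  qed (rule modulate_dual_space[OF dual])+
  then have "\<phi> (modulate h f) = 0" using f by (simp add: annihilator_def)
  with \<phi>(2) show False by simp
qed

section \<open>Closed ideals are determined by their zero sets\<close>

text \<open>At each point \<open>t\<close> some element \<open>G t\<close> of \<open>J\<close> has the same value as \<open>f\<close>: zero if \<open>t\<close> is a common
  zero of \<open>J\<close>, otherwise a multiple of an element of \<open>J\<close> that does not vanish at \<open>t\<close>. By
  compactness, finitely many of the open sets on which \<open>G t\<close> is within \<open>e\<close> of \<open>f\<close> cover the
  space, and a partition of unity subordinate to them glues the \<open>G t\<close> to an element of \<open>J\<close> within
  \<open>e\<close> of \<open>f\<close>.\<close>

lemma closed_ideal_is_vanishing_ideal:
  fixes J :: "('a::metric_space \<Rightarrow>\<^sub>C 'k::real_normed_field) set"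
  assumes compact: "compact (UNIV :: 'a set)"
    and J: "module.subspace bcf_scale J" "closed J"
    and ideal: "\<And>h f. (\<And>x. 0 \<le> apply_bcontfun h x) \<Longrightarrow> (\<And>x. apply_bcontfun h x \<le> 1) \<Longrightarrow> f \<in> J \<Longrightarrow>
      modulate h f \<in> J"
    and f: "\<And>x. (\<forall>g\<in>J. apply_bcontfun g x = 0) \<Longrightarrow> apply_bcontfun f x = 0"
  shows "f \<in> J"
proof -
  interpret vector_space "bcf_scale :: 'k \<Rightarrow> ('a \<Rightarrow>\<^sub>C 'k) \<Rightarrow> _" by (rule vector_space_bcf_scale)
  have "\<exists>g\<in>J. norm (f - g) \<le> e" if e: "e > 0" for e
  proof -
    have "\<exists>g\<in>J. apply_bcontfun g t = apply_bcontfun f t" for t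
    proof (cases "\<forall>g\<in>J. apply_bcontfun g t = 0")
      case True
      then show ?thesis using f[of t] subspace_0[OF J(1)] by (intro bexI[of _ 0]) simp_all
    next
      case False
      then obtain g where g: "g \<in> J" "apply_bcontfun g t \<noteq> 0" by blast
      then show ?thesis
        by (intro bexI[of _ "bcf_scale (apply_bcontfun f t / apply_bcontfun g t) g"])
          (simp_all add: subspace_scale[OF J(1)])
    qed
    then obtain G where G: "\<And>t. G t \<in> J" "\<And>t. apply_bcontfun (G t) t = apply_bcontfun f t"
      by metis
    define w where "w t x = max 0 (e - norm (apply_bcontfun (G t) x - apply_bcontfun f x))" for t x
    have w_cont: "continuous_on UNIV (w t)" for t
      unfolding w_def by (intro continuous_intros continuous_on_apply_bcontfun)
    have w_nonneg: "0 \<le> w t x" for t x by (simp add: w_def)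
    have "open {x. 0 < w t x}" for t
      by (intro open_Collect_less continuous_intros w_cont)
    moreover have "UNIV \<subseteq> (\<Union>t\<in>UNIV. {x. 0 < w t x})"
      using G(2) e by (auto simp: w_def intro!: exI)
    ultimately obtain F where F: "finite F" "UNIV \<subseteq> (\<Union>t\<in>F. {x. 0 < w t x})"
      using compactE_image[OF compact, of UNIV "\<lambda>t. {x. 0 < w t x}"] by metis
    define W where "W x = (\<Sum>t\<in>F. w t x)" for x
    have W_pos: "0 < W x" for x
    proof -
      obtain t where "t \<in> F" "0 < w t x" using F(2) by blast
      then show ?thesis
        unfolding W_def using F(1) by (intro sum_pos2[of F t]) (auto simp: w_nonneg)
    qed
    define h where "h t = Bcontfun (\<lambda>x. w t x / W x)" for t
    have w_le: "w t x \<le> W x" if "t \<in> F" for t x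
      unfolding W_def using F(1) that by (intro member_le_sum) (auto simp: w_nonneg)
    have h: "apply_bcontfun (h t) x = w t x / W x" if "t \<in> F" for t x
    proof -
      have "(\<lambda>x. w t x / W x) \<in> bcontfun"
      proof (rule bcontfun_normI)
        show "continuous_on UNIV (\<lambda>x. w t x / W x)"
          using W_pos unfolding W_def by (intro continuous_intros w_cont) (auto simp: less_le)
        show "norm (w t x / W x) \<le> 1" for x
          using W_pos[of x] w_nonneg[of t x] w_le[OF that, of x] by simp
      qed
      then show ?thesis by (simp add: h_def Bcontfun_inverse)
    qed
    have h_nonneg: "0 \<le> apply_bcontfun (h t) x" and h_le: "apply_bcontfun (h t) x \<le> 1" if "t \<in> F" for t x
      using W_pos[of x] w_nonneg[of t x] w_le[OF that, of x] by (simp_all add: h[OF that])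
    have h_sum: "(\<Sum>t\<in>F. apply_bcontfun (h t) x) = 1" for x
      using W_pos[of x] by (simp add: h flip: sum_divide_distrib W_def)
    define g where "g = (\<Sum>t\<in>F. modulate (h t) (G t))"
    have "g \<in> J"
      unfolding g_def using h_nonneg h_le by (intro subspace_sum[OF J(1)] ideal G(1))
    moreover have "norm (f - g) \<le> e"
    proof (rule norm_bound)
      fix x
      have app: "apply_bcontfun (\<Sum>t\<in>F. v t) x = (\<Sum>t\<in>F. apply_bcontfun (v t) x)" for v :: "'a \<Rightarrow> 'a \<Rightarrow>\<^sub>C 'k"
        using F(1) by induction auto
      have "apply_bcontfun f x = (\<Sum>t\<in>F. apply_bcontfun (h t) x) *\<^sub>R apply_bcontfun f x"
        by (simp add: h_sum)
      then have "apply_bcontfun (f - g) x =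
          (\<Sum>t\<in>F. apply_bcontfun (h t) x *\<^sub>R (apply_bcontfun f x - apply_bcontfun (G t) x))"
        by (simp add: g_def app scaleR_sum_left scaleR_diff_right sum_subtractf)
      also have "norm \<dots> \<le> (\<Sum>t\<in>F. apply_bcontfun (h t) x * e)"
      proof (rule sum_norm_le)
        fix t assume t: "t \<in> F"
        show "norm (apply_bcontfun (h t) x *\<^sub>R (apply_bcontfun f x - apply_bcontfun (G t) x))
            \<le> apply_bcontfun (h t) x * e"
        proof (cases "w t x = 0")
          case True
          then show ?thesis by (simp add: h[OF t])
        next
          case False
          then have "norm (apply_bcontfun f x - apply_bcontfun (G t) x) \<le> e"
            by (auto simp: w_def norm_minus_commute max_def split: if_splits)
          then show ?thesis using h_nonneg[OF t, of x] by (simp add: mult_left_mono)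
        qed
      qed
      also have "\<dots> = e" by (simp add: h_sum flip: sum_distrib_right)
      finally show "norm (apply_bcontfun (f - g) x) \<le> e" .
    qed
    ultimately show ?thesis by blast
  qed
  note approx = this
  have "f \<in> closure J"
    unfolding closure_approachable
  proof (intro allI impI)
    fix e :: real assume "e > 0"
    then obtain g where "g \<in> J" "norm (f - g) \<le> e / 2" using approx[of "e / 2"] by auto
    then show "\<exists>g\<in>J. dist g f < e"
      using \<open>e > 0\<close> by (intro bexI[of _ g]) (auto simp: dist_norm norm_minus_commute)
  qed
  then show ?thesis using J(2) by simp
qed

section \<open>Contractive linear extension from a closed subset\<close>

locale dense_sequence =
  fixes D :: "'a::metric_space set" and a :: "nat \<Rightarrow> 'a"
  assumes closed: "closed D" and a_in: "a k \<in> D" and dense: "D \<subseteq> closure (range a)"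
begin

text \<open>The factor \<open>(1 / 2) ^ k\<close> makes all series converge uniformly. The other factor is at most 2 and
  is positive if and only if \<open>dist x (a k) < 2 * infdist x D\<close>, for \<open>x \<notin> D\<close>; so only points of the
  sequence that are nearly closest to \<open>x\<close> contribute to the mean at \<open>x\<close>.\<close>

definition weight :: "nat \<Rightarrow> 'a \<Rightarrow> real"
  where "weight k x = (1 / 2) ^ k * max 0 (2 - dist x (a k) / infdist x D)"

definition total :: "'a \<Rightarrow> real"
  where "total x = (\<Sum>k. weight k x)"

lemma infdist_pos: "x \<notin> D \<Longrightarrow> 0 < infdist x D"
  using infdist_pos_not_in_closed[OF closed] a_in by blast

lemma weight_nonneg: "0 \<le> weight k x"
  by (simp add: weight_def)

lemma weight_le: "weight k x \<le> 2 * (1 / 2) ^ k"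
proof -
  have "max 0 (2 - dist x (a k) / infdist x D) \<le> 2"
    by (simp add: infdist_nonneg)
  then show ?thesis
    unfolding weight_def by (subst mult.commute) (intro mult_right_mono, simp_all)
qed

lemma summable_weight_bound: "summable (\<lambda>k. 2 * (1 / 2) ^ k * B :: real)"
  by (intro summable_mult summable_mult2 summable_geometric) simp

lemma summable_weight: "summable (\<lambda>k. weight k x)"
  using summable_weight_bound[of 1]
  by (rule summable_comparison_test[rotated]) (use weight_nonneg weight_le in auto)

lemma continuous_weight: "continuous_on (- D) (weight k)"
  unfolding weight_def
  by (intro continuous_intros) (use infdist_pos in force)

text \<open>A point of \<open>D\<close> at distance less than \<open>2 * infdist x D\<close> from \<open>x\<close> is approximated by the
  sequence, so some weight is positive.\<close>

lemma total_pos: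
  assumes x: "x \<notin> D"
  shows "0 < total x"
proof -
  have "infdist x D < 2 * infdist x D" using infdist_pos[OF x] by simp
  then have "\<exists>d\<in>D. dist x d < 2 * infdist x D"
    using infdist_notempty[of D x] a_in cINF_greatest[of D "2 * infdist x D" "dist x"]
    by (metis empty_iff not_less)
  then obtain d where d: "d \<in> D" "dist x d < 2 * infdist x D" by blast
  then obtain k where "dist (a k) d < 2 * infdist x D - dist x d"
    using dense by (force simp: closure_approachable subset_eq)
  then have "dist x (a k) < 2 * infdist x D"
    using dist_triangle[of x "a k" d] by (simp add: dist_commute)
  then have "0 < weight k x"
    using infdist_pos[OF x] by (simp add: weight_def field_simps)
  then show ?thesis
    unfolding total_def by (intro suminf_pos2[OF summable_weight]) (auto simp: weight_nonneg)
qed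

text \<open>This makes the mean at \<open>y\<close> converge to \<open>f x\<close> as \<open>y\<close> tends to a point \<open>x\<close> of \<open>D\<close>.\<close>

lemma near_if_weight_nonzero:
  assumes "weight k y \<noteq> 0" "x \<in> D" "y \<notin> D"
  shows "dist (a k) x \<le> 3 * dist y x"
proof -
  have "dist y (a k) < 2 * infdist y D"
    using assms(1) infdist_pos[OF assms(3)] by (auto simp: weight_def max_def field_simps split: if_splits)
  also have "infdist y D \<le> dist y x" by (rule infdist_le[OF assms(2)])
  finally show ?thesis
    using dist_triangle2[of "a k" x y] by (simp add: dist_commute)
qed

definition average :: "('a \<Rightarrow> 'b::{real_normed_field,banach}) \<Rightarrow> 'a \<Rightarrow> 'b"
  where "average f x = (\<Sum>k. weight k x *\<^sub>R f (a k)) /\<^sub>R total x"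

lemma summable_weighted:
  fixes f :: "'a \<Rightarrow> 'b::{real_normed_field,banach}"
  assumes "\<And>x. norm (f x) \<le> B"
  shows "summable (\<lambda>k. weight k x *\<^sub>R f (a k))"
proof (rule summable_comparison_test[OF _ summable_weight_bound[of B]])
  show "\<exists>N. \<forall>k\<ge>N. norm (weight k x *\<^sub>R f (a k)) \<le> 2 * (1 / 2) ^ k * B"
    using weight_nonneg weight_le assms by (auto intro!: exI[of _ 0] mult_mono)
qed

text \<open>The series for the mean and for the total weight converge uniformly off \<open>D\<close>, by the Weierstrass
  M-test.\<close>

lemma continuous_average:
  fixes f :: "'a \<Rightarrow> 'b::{real_normed_field,banach}"
  assumes f: "\<And>x. norm (f x) \<le> B"
  shows "continuous_on (- D) (average f)"
proof -
  have series: "continuous_on (- D) (\<lambda>x. \<Sum>k. weight k x *\<^sub>R g (a k))"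
    if g: "\<And>x. norm (g x) \<le> C" for g :: "'a \<Rightarrow> 'c::{real_normed_field,banach}" and C
  proof (rule uniform_limit_theorem)
    show "uniform_limit (- D) (\<lambda>n x. \<Sum>k<n. weight k x *\<^sub>R g (a k))
        (\<lambda>x. \<Sum>k. weight k x *\<^sub>R g (a k)) sequentially"
    proof (rule Weierstrass_m_test[OF _ summable_weight_bound[of C]])
      show "norm (weight k x *\<^sub>R g (a k)) \<le> 2 * (1 / 2) ^ k * C" for k x
        using weight_nonneg weight_le g by (auto intro!: mult_mono)
    qed
  qed (auto intro!: always_eventually continuous_intros continuous_weight)
  have "continuous_on (- D) total"
    using series[of "\<lambda>_. 1 :: real" 1] by (simp add: total_def[abs_def])
  then show ?thesis
    unfolding average_def using total_pos
    by (intro continuous_intros series[OF f]) force+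
qed

text \<open>A weighted mean of values that lie within \<open>e\<close> of \<open>c\<close> lies within \<open>e\<close> of \<open>c\<close>. With \<open>c = 0\<close> this
  bounds the extension; with \<open>c\<close> a value of \<open>f\<close> on \<open>D\<close> it gives continuity at the points of \<open>D\<close>.\<close>

lemma average_near:
  fixes f :: "'a \<Rightarrow> 'b::{real_normed_field,banach}"
  assumes x: "x \<notin> D" and f: "\<And>x. norm (f x) \<le> B"
    and near: "\<And>k. weight k x \<noteq> 0 \<Longrightarrow> norm (f (a k) - c) \<le> e"
  shows "norm (average f x - c) \<le> e"
proof -
  note total_pos = total_pos[OF x]
  have sf: "summable (\<lambda>k. weight k x *\<^sub>R f (a k))" by (rule summable_weighted[OF f])
  have sc: "summable (\<lambda>k. weight k x *\<^sub>R c)" by (rule summable_scaleR_left[OF summable_weight])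
  have diff: "(\<Sum>k. weight k x *\<^sub>R (f (a k) - c)) = (\<Sum>k. weight k x *\<^sub>R f (a k)) - total x *\<^sub>R c"
    using suminf_diff[OF sf sc] suminf_scaleR_left[OF summable_weight, of x c]
    by (simp add: total_def scaleR_diff_right)
  have "norm (weight k x *\<^sub>R (f (a k) - c)) \<le> weight k x * e" for k
    using near[of k] weight_nonneg[of k x] by (cases "weight k x = 0") (auto intro: mult_left_mono)
  then have "norm (\<Sum>k. weight k x *\<^sub>R (f (a k) - c)) \<le> (\<Sum>k. weight k x * e)"
    by (rule norm_suminf_le) (intro summable_mult2 summable_weight)
  also have "\<dots> = total x * e"
    by (simp add: total_def suminf_mult2[OF summable_weight])
  finally have *: "norm ((\<Sum>k. weight k x *\<^sub>R f (a k)) - total x *\<^sub>R c) \<le> total x * e"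
    by (simp only: diff)
  have "average f x - c = ((\<Sum>k. weight k x *\<^sub>R f (a k)) - total x *\<^sub>R c) /\<^sub>R total x"
    using total_pos by (simp add: average_def scaleR_diff_right)
  then show ?thesis
    using * total_pos by (simp add: divide_inverse_commute[symmetric] pos_divide_le_eq mult.commute)
qed

definition extend :: "('a \<Rightarrow>\<^sub>C 'b::{real_normed_field,banach}) \<Rightarrow> 'a \<Rightarrow>\<^sub>C 'b"
  where "extend f = Bcontfun (\<lambda>x. if x \<in> D then apply_bcontfun f x else average (apply_bcontfun f) x)"

lemma norm_average_le:
  assumes "x \<notin> D"
  shows "norm (average (apply_bcontfun f) x) \<le> norm f"
  using average_near[OF assms norm_bounded[of f], where c = 0 and e = "norm f"] norm_bounded[of f] by simp

lemma apply_extend: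
  "apply_bcontfun (extend f) x = (if x \<in> D then apply_bcontfun f x else average (apply_bcontfun f) x)"
proof -
  let ?g = "\<lambda>x. if x \<in> D then apply_bcontfun f x else average (apply_bcontfun f) x"
  have "isCont ?g x" for x
  proof (cases "x \<in> D")
    case False
    have op: "open (- D)" using closed by blast
    have "isCont (average (apply_bcontfun f)) x"
      using continuous_average[OF norm_bounded[of f]] op False
      by (simp add: continuous_on_eq_continuous_at)
    moreover have "\<forall>\<^sub>F y in nhds x. ?g y = average (apply_bcontfun f) y"
      using eventually_nhds_in_open[OF op, of x] False by (auto elim!: eventually_mono)
    ultimately show ?thesis by (simp add: isCont_cong)
  next
    case True
    show ?thesis
      unfolding continuous_at_eps_delta
    proof (intro allI impI)
      fix e :: real assume e: "e > 0"
      have "isCont (apply_bcontfun f) x"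
        using continuous_on_apply_bcontfun[of UNIV f]
        by (simp add: continuous_on_eq_continuous_at del: continuous_on_apply_bcontfun)
      then obtain d where d: "d > 0"
          "\<And>y. dist y x < d \<Longrightarrow> dist (apply_bcontfun f y) (apply_bcontfun f x) < e / 2"
        unfolding continuous_at_eps_delta using e half_gt_zero by blast
      have "dist (?g y) (?g x) < e" if y: "dist y x < d / 3" for y
      proof (cases "y \<in> D")
        case True
        have "dist y x < d" using y d(1) by simp
        from d(2)[OF this] True \<open>x \<in> D\<close> e show ?thesis by simp
      next
        case False
        have "norm (average (apply_bcontfun f) y - apply_bcontfun f x) \<le> e / 2"
        proof (rule average_near[OF False norm_bounded])
          fix k assume "weight k y \<noteq> 0"
          from near_if_weight_nonzero[OF this \<open>x \<in> D\<close> False] y have "dist (a k) x < d" by simp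
          from d(2)[OF this] show "norm (apply_bcontfun f (a k) - apply_bcontfun f x) \<le> e / 2"
            by (simp add: dist_norm)
        qed
        with False \<open>x \<in> D\<close> e show ?thesis by (simp add: dist_norm)
      qed
      then show "\<exists>d>0. \<forall>y. dist y x < d \<longrightarrow> dist (?g y) (?g x) < e"
        \<comment> \<open>The points that contribute at \<open>y\<close> are at most three times as far from \<open>x\<close> as \<open>y\<close> is.\<close>
        using d(1) by (intro exI[of _ "d / 3"]) auto
    qed
  qed
  then have "continuous_on UNIV ?g" by (simp add: continuous_on_eq_continuous_at)
  then have "?g \<in> bcontfun"
    by (rule bcontfun_normI[where b = "norm f"]) (auto simp: norm_bounded norm_average_le)
  then show ?thesis by (simp add: extend_def Bcontfun_inverse)
qed

lemma norm_extend_le: "norm (extend f) \<le> norm f"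
  by (rule norm_bound) (simp add: apply_extend norm_bounded norm_average_le)

lemma extend_add: "extend (f + g) = extend f + extend g"
proof (rule bcontfun_eqI)
  fix x
  have "average (\<lambda>x. apply_bcontfun f x + apply_bcontfun g x) x =
      average (apply_bcontfun f) x + average (apply_bcontfun g) x"
    unfolding average_def scaleR_add_right
    by (subst suminf_add[symmetric]) (auto intro!: summable_weighted norm_bounded simp: scaleR_add_right)
  then show "apply_bcontfun (extend (f + g)) x = apply_bcontfun (extend f + extend g) x"
    by (simp add: apply_extend plus_bcontfun.rep_eq[abs_def])
qed

lemma extend_scale: "extend (bcf_scale c f) = bcf_scale c (extend f)"
proof (rule bcontfun_eqI)
  fix x
  have "average (\<lambda>x. c * apply_bcontfun f x) x = c * average (apply_bcontfun f) x"
    using suminf_mult[OF summable_weighted[of "apply_bcontfun f", OF norm_bounded], of c x]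
    by (simp add: average_def)
  moreover have "apply_bcontfun (bcf_scale c f) = (\<lambda>x. c * apply_bcontfun f x)" by (rule ext) simp
  ultimately show "apply_bcontfun (extend (bcf_scale c f)) x = apply_bcontfun (bcf_scale c (extend f)) x"
    by (simp add: apply_extend)
qed

lemma extend_eq_0:
  assumes "\<And>x. x \<in> D \<Longrightarrow> apply_bcontfun f x = 0"
  shows "extend f = 0"
  by (rule bcontfun_eqI) (simp add: apply_extend average_def assms a_in)

end

section \<open>Linear selections of the metric projection\<close>

text \<open>For \<open>j \<in> J\<close> we have \<open>T f = T (f - j)\<close>, hence \<open>\<parallel>T f\<parallel> \<le> \<parallel>f - j\<parallel>\<close>; so \<open>f - T f\<close>, whose distance
  from \<open>f\<close> is \<open>\<parallel>T f\<parallel>\<close>, is a closest point of \<open>J\<close>.\<close>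

lemma linear_selection_of_contractive_projection:
  fixes J :: "('a::metric_space \<Rightarrow>\<^sub>C 'k::{real_normed_field,banach}) set"
  assumes add: "\<And>f g. T (f + g) = T f + T g"
    and scale: "\<And>c f. T (bcf_scale c f) = bcf_scale c (T f)"
    and contractive: "\<And>f. norm (T f) \<le> norm f"
    and kills: "\<And>f. f \<in> J \<Longrightarrow> T f = 0"
    and residual: "\<And>f. f - T f \<in> J"
  shows "linear_selection bcf_scale (metric_projection J) (\<lambda>f. f - T f)"
proof -
  interpret V: vector_space "bcf_scale :: 'k \<Rightarrow> ('a \<Rightarrow>\<^sub>C 'k) \<Rightarrow> _"
    by (rule vector_space_bcf_scale)
  have T_bound: "norm (T f) \<le> dist f j" if "j \<in> J" for f j
    using add[of "f - j" j] kills[OF that] contractive[of "f - j"] by (simp add: dist_norm)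
  have "infdist f J = norm (T f)" for f
  proof (rule antisym)
    show "infdist f J \<le> norm (T f)"
      using infdist_le[OF residual, of f f] by (simp add: dist_norm)
    have "J \<noteq> {}" using residual by blast
    then show "norm (T f) \<le> infdist f J"
      by (simp add: infdist_notempty cINF_greatest T_bound)
  qed
  then show ?thesis
    by (auto simp: linear_selection_def Vector_Spaces.linear_iff V.vector_space_axioms
        metric_projection_def residual add scale V.scale_right_diff_distrib)
qed

text \<open>The cube is isometric to a subset of Euclidean space, every subset of which is separable.\<close>

lemma dense_sequence_exists:
  fixes D :: "'n::finite unit_cube set"
  assumes "closed D" "D \<noteq> {}"
  obtains a where "dense_sequence D a"
proof -
  obtain T where T: "countable T" "T \<subseteq> Rep_unit_cube ` D" "Rep_unit_cube ` D \<subseteq> closure T"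
    by (rule separable)
  have "T \<noteq> {}" using T(3) assms(2) by auto
  then have t: "T = range (from_nat_into T)"
    using range_from_nat_into[OF _ T(1)] by simp
  have "\<exists>y. y \<in> D \<and> from_nat_into T k = Rep_unit_cube y" for k
    using T(2) from_nat_into[OF \<open>T \<noteq> {}\<close>, of k] by blast
  then obtain a where a: "\<And>k. a k \<in> D" "\<And>k. from_nat_into T k = Rep_unit_cube (a k)" by metis
  have "D \<subseteq> closure (range a)"
  proof
    fix x assume "x \<in> D"
    then have "Rep_unit_cube x \<in> closure (range (from_nat_into T))"
      using T(3) t by auto
    then show "x \<in> closure (range a)"
      by (auto simp: closure_approachable dist_unit_cube_def a(2))
  qed
  with a(1) assms(1) show ?thesis
    by (intro that[of a]) (simp add: dense_sequence_def)
qed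

theorem metric_projection_linear_selection:
  fixes J :: "('n::finite unit_cube \<Rightarrow>\<^sub>C 'k::{real_normed_field,banach}) set"
  assumes J: "M_ideal bcf_scale J"
    and separates: "\<And>f. f \<notin> J \<Longrightarrow> \<exists>\<phi>\<in>annihilator bcf_scale J. \<phi> f \<noteq> 0"
  shows "\<exists>p. linear_selection bcf_scale (metric_projection J) p"
proof -
  interpret V: vector_space "bcf_scale :: 'k \<Rightarrow> ('n unit_cube \<Rightarrow>\<^sub>C 'k) \<Rightarrow> _"
    by (rule vector_space_bcf_scale)
  define D where "D = {x. \<forall>f\<in>J. apply_bcontfun f x = 0}"
  have "closed {x. apply_bcontfun f x = 0}" for f :: "'n unit_cube \<Rightarrow>\<^sub>C 'k"
    by (intro closed_Collect_eq continuous_on_apply_bcontfun continuous_on_const)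
  moreover have "D = (\<Inter>f\<in>J. {x. apply_bcontfun f x = 0})"
    by (auto simp: D_def)
  ultimately have closed: "closed D" by (simp add: closed_INT)
  have subspace: "module.subspace bcf_scale J" and J_closed: "closed J"
    using J by (simp_all add: M_ideal_def)
  have memI: "f \<in> J" if "\<And>x. x \<in> D \<Longrightarrow> apply_bcontfun f x = 0" for f
    using closed_ideal_is_vanishing_ideal[OF compact_UNIV_unit_cube subspace J_closed]
      M_ideal_modulate_closed[OF J separates] that
    by (simp add: D_def)
  show ?thesis
  proof (cases "D = {}")
    case True
    have "linear_selection bcf_scale (metric_projection J) (\<lambda>f. f - 0)"
      by (rule linear_selection_of_contractive_projection) (use True memI in auto)
    then show ?thesis by blast
  next
    case False
    then obtain a where "dense_sequence D a" using dense_sequence_exists[OF closed] by blast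
    then interpret dense_sequence D a .
    have "linear_selection bcf_scale (metric_projection J) (\<lambda>f. f - extend f)"
    proof (rule linear_selection_of_contractive_projection)
      show "extend f = 0" if "f \<in> J" for f :: "'n unit_cube \<Rightarrow>\<^sub>C 'k"
        using that by (intro extend_eq_0) (simp add: D_def)
      show "f - extend f \<in> J" for f
        by (rule memI) (simp add: apply_extend)
    qed (rule extend_add extend_scale norm_extend_le)+
    then show ?thesis by blast
  qed
qed

theorem proposition24:
  fixes J :: "('n::finite unit_cube \<Rightarrow>\<^sub>C real) set"
    and J' :: "('n unit_cube \<Rightarrow>\<^sub>C complex) set"
  shows "(M_ideal bcf_scale J \<longrightarrow>
            (\<exists>p. linear_selection bcf_scale (metric_projection J) p)) \<and>
         (M_ideal bcf_scale J' \<longrightarrow>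
            (\<exists>p. linear_selection bcf_scale (metric_projection J') p))"
proof (intro conjI impI)
  assume J: "M_ideal bcf_scale J"
  then have *: "module.subspace bcf_scale J" "closed J" by (simp_all add: M_ideal_def)
  show "\<exists>p. linear_selection bcf_scale (metric_projection J) p"
  proof (rule metric_projection_linear_selection[OF J])
    show "\<exists>\<phi>\<in>annihilator bcf_scale J. \<phi> f \<noteq> 0" if "f \<notin> J" for f
      using real_annihilator_separates[OF * that] by blast
  qed
next
  assume J': "M_ideal bcf_scale J'"
  then have *: "module.subspace bcf_scale J'" "closed J'" by (simp_all add: M_ideal_def)
  show "\<exists>p. linear_selection bcf_scale (metric_projection J') p"
  proof (rule metric_projection_linear_selection[OF J'])
    show "\<exists>\<phi>\<in>annihilator bcf_scale J'. \<phi> f \<noteq> 0" if "f \<notin> J'" for f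
      using complex_annihilator_separates[OF * that] by blast
  qed
qed

end
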